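(* Let $\alpha,\beta,\gamma>0$ and $\mu,r\in\mathbb{R}$. For any $y\in\mathbb{R}$, the Sender-optimal threshold $x^{*}(y)\in\arg\max_{x\in\mathbb{R}}\Pi(x,y)$ is unique and given by $$x^{*}(y)=-\frac{1}{\beta}\left(\alpha y+\gamma\mu+h_{\theta|x,y}\,r\right),\qquad h_{\theta|x,y}=\alpha+\beta+\gamma .$$ Moreover, the endogenous conflict of interests $\Delta=\hat{x}(y)-x^{*}(y)$ is given by $$\Delta=\frac{h_{\theta|x,y}}{\beta}\,r .$$
   Context: Let $\theta\sim N(\mu,\gamma^{-1})$, and conditionally on $\theta$ let $x\sim N(\theta,\beta^{-1})$ (a receiver's private signal) and $y\sim N(\theta,\alpha^{-1})$ (the Sender's signal) be independent. $F(x|\theta)$ denotes the conditional c.d.f. of the private signal given $\theta$, and $F(\theta|y)$ the conditional c.d.f. of $\theta$ given the Sender's signal $y$. A continuum of receivers each chooses $a_i\in\{0,1\}$ with payoff $rA+a_i\theta$, where $A=\int_0^1a_i\,di$. If all receivers use the threshold rule $a_i=\mathbf{1}_{x_i\ge x}$, the aggregate action is $A=1-F(x|\theta)$ and aggregate welfare in state $\theta$ is $(r+\theta)(1-F(x|\theta))$. The benevolent Sender's interim expected payoff after observing $y$ is $$\Pi(x,y)=\int_{\mathbb{R}}(r+\theta)\left(1-F(x|\theta)\right)dF(\theta|y).$$ $\hat{x}(y)$ denotes the threshold receivers use in equilibrium when $y$ is publicly disclosed, i.e. the solution $\hat x$ of $\mathbb{E}[\theta\,|\,x=\hat x,y]=0$,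 namely $\hat{x}(y)=-\frac{1}{\beta}(\alpha y+\gamma\mu)$. *)

theory Defs
  imports "HOL-Probability.Probability"
begin

text \<open>
  Normal distributions are parametrised by their precision (inverse variance):
  \<open>\<gamma>\<close> for the state, \<open>\<beta>\<close> for a private signal and \<open>\<alpha>\<close> for the Sender's signal.  The library's
  \<open>normal_density\<close> takes the standard deviation, i.e. one over the square root of the precision.
\<close>

definition gauss :: "real \<Rightarrow> real \<Rightarrow> real \<Rightarrow> real" where
  "gauss m p = normal_density m (1 / sqrt p)"

text \<open>
  The joint density of \<open>(\<theta>, x, y)\<close>; the product of the two signal densities expresses their
  independence conditionally on \<open>\<theta>\<close>.
\<close>

definition joint_density ::
  "real \<Rightarrow> real \<Rightarrow> real \<Rightarrow> real \<Rightarrow> real \<Rightarrow> real \<Rightarrow> real \<Rightarrow> real" where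
  "joint_density \<alpha> \<beta> \<gamma> \<mu> \<theta> x y = gauss \<mu> \<gamma> \<theta> * gauss \<theta> \<beta> x * gauss \<theta> \<alpha> y"

definition state_sender_density ::
  "real \<Rightarrow> real \<Rightarrow> real \<Rightarrow> real \<Rightarrow> real \<Rightarrow> real \<Rightarrow> real" where
  "state_sender_density \<alpha> \<beta> \<gamma> \<mu> \<theta> y = (LINT x|lborel. joint_density \<alpha> \<beta> \<gamma> \<mu> \<theta> x y)"

text \<open>
  Conditional laws of the state given a signal realisation, with density
  (joint density) / (marginal density of the signals).  The marginal densities are positive and
  continuous everywhere, so this fixes the usual version of the conditional law at every point,
  not merely almost everywhere.
\<close>

definition state_given_sender ::
  "real \<Rightarrow> real \<Rightarrow> real \<Rightarrow> real \<Rightarrow> real \<Rightarrow> real measure" where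
  "state_given_sender \<alpha> \<beta> \<gamma> \<mu> y =
     density lborel (\<lambda>\<theta>. ennreal (state_sender_density \<alpha> \<beta> \<gamma> \<mu> \<theta> y /
       (LINT t|lborel. state_sender_density \<alpha> \<beta> \<gamma> \<mu> t y)))"

definition state_given_both ::
  "real \<Rightarrow> real \<Rightarrow> real \<Rightarrow> real \<Rightarrow> real \<Rightarrow> real \<Rightarrow> real measure" where
  "state_given_both \<alpha> \<beta> \<gamma> \<mu> x y =
     density lborel (\<lambda>\<theta>. ennreal (joint_density \<alpha> \<beta> \<gamma> \<mu> \<theta> x y /
       (LINT t|lborel. joint_density \<alpha> \<beta> \<gamma> \<mu> t x y)))"

definition private_cdf :: "real \<Rightarrow> real \<Rightarrow> real \<Rightarrow> real" where
  "private_cdf \<beta> x \<theta> = cdf (density lborel (\<lambda>s. ennreal (gauss \<theta> \<beta> s))) x"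

text \<open>Integrating against the law \<open>state_given_sender\<close> is integrating against \<open>dF(\<theta>|y)\<close>.\<close>

definition interim_payoff ::
  "real \<Rightarrow> real \<Rightarrow> real \<Rightarrow> real \<Rightarrow> real \<Rightarrow> real \<Rightarrow> real \<Rightarrow> real" where
  "interim_payoff \<alpha> \<beta> \<gamma> \<mu> r x y =
     (LINT \<theta>|state_given_sender \<alpha> \<beta> \<gamma> \<mu> y. (r + \<theta>) * (1 - private_cdf \<beta> x \<theta>))"

definition sender_optimal ::
  "real \<Rightarrow> real \<Rightarrow> real \<Rightarrow> real \<Rightarrow> real \<Rightarrow> real \<Rightarrow> real \<Rightarrow> bool" where
  "sender_optimal \<alpha> \<beta> \<gamma> \<mu> r y x \<longleftrightarrow>
     is_arg_max (\<lambda>x'. interim_payoff \<alpha> \<beta> \<gamma> \<mu> r x' y) (\<lambda>_. True) x"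

definition optimal_threshold ::
  "real \<Rightarrow> real \<Rightarrow> real \<Rightarrow> real \<Rightarrow> real \<Rightarrow> real \<Rightarrow> real" where
  "optimal_threshold \<alpha> \<beta> \<gamma> \<mu> r y = (THE x. sender_optimal \<alpha> \<beta> \<gamma> \<mu> r y x)"

definition posterior_mean ::
  "real \<Rightarrow> real \<Rightarrow> real \<Rightarrow> real \<Rightarrow> real \<Rightarrow> real \<Rightarrow> real" where
  "posterior_mean \<alpha> \<beta> \<gamma> \<mu> x y = (LINT \<theta>|state_given_both \<alpha> \<beta> \<gamma> \<mu> x y. \<theta>)"

text \<open>
  A receiver acts when the expected state is nonnegative, so under public disclosure of \<open>y\<close> the
  equilibrium threshold is the private signal at which the posterior mean vanishes.
\<close>

definition equilibrium_threshold ::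
  "real \<Rightarrow> real \<Rightarrow> real \<Rightarrow> real \<Rightarrow> real \<Rightarrow> real" where
  "equilibrium_threshold \<alpha> \<beta> \<gamma> \<mu> y = (THE x. posterior_mean \<alpha> \<beta> \<gamma> \<mu> x y = 0)"

definition conflict :: "real \<Rightarrow> real \<Rightarrow> real \<Rightarrow> real \<Rightarrow> real \<Rightarrow> real \<Rightarrow> real" where
  "conflict \<alpha> \<beta> \<gamma> \<mu> r y = equilibrium_threshold \<alpha> \<beta> \<gamma> \<mu> y - optimal_threshold \<alpha> \<beta> \<gamma> \<mu> r y"

definition posterior_precision :: "real \<Rightarrow> real \<Rightarrow> real \<Rightarrow> real" where
  "posterior_precision \<alpha> \<beta> \<gamma> = \<alpha> + \<beta> + \<gamma>"

end

theory Submission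
  imports Defs
begin

text \<open>
  Conjugacy of the normal family gives \<open>\<theta> | y \<sim> N(m, 1/P)\<close> with \<open>P = \<alpha> + \<gamma>\<close> and
  \<open>m = (\<gamma> \<mu> + \<alpha> y) / P\<close>.  Writing \<open>1 - F(x|\<theta>)\<close> as the integral of the signal density over
  \<open>s > x\<close> and exchanging the integrals turns the payoff into the integral over \<open>s > x\<close> of
  \<open>f(s|y) * (r + E[\<theta> | s, y])\<close>.  The second factor is affine and increasing in \<open>s\<close>, so the unique
  maximiser is its zero; no differentiation in \<open>x\<close> is needed.
\<close>

section \<open>Normal densities in terms of the precision\<close>

lemma gauss_eq_exp:
  assumes "p > 0"
  shows "gauss m p x = sqrt (p / (2 * pi)) * exp (- (p * (x - m)\<^sup>2 / 2))"
  using assms by (simp add: gauss_def normal_density_def power_divide real_sqrt_divide)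

lemma gauss_pos: "p > 0 \<Longrightarrow> gauss m p x > 0"
  by (simp add: gauss_def normal_density_pos)

lemma gauss_nonneg: "gauss m p x \<ge> 0"
  by (simp add: gauss_def)

lemma borel_measurable_gauss [measurable]:
  assumes [measurable]: "f \<in> borel_measurable M" "g \<in> borel_measurable M"
  shows "(\<lambda>w. gauss (f w) p (g w)) \<in> borel_measurable M"
  unfolding gauss_def normal_density_def by measurable

lemma integrable_gauss: "p > 0 \<Longrightarrow> integrable lborel (gauss m p)"
  by (simp add: gauss_def)

lemma integral_gauss: "p > 0 \<Longrightarrow> (LINT x|lborel. gauss m p x) = 1"
  by (simp add: gauss_def)

text \<open>Affine integrands cover every expectation taken below: the posterior mean, the payoff
  weight \<open>r + \<theta>\<close>, and the kernel whose sign decides the optimum.\<close>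

lemma has_bochner_integral_gauss_affine:
  assumes "p > 0"
  shows "has_bochner_integral lborel (\<lambda>x. gauss m p x * (a + b * x)) (a + b * m)"
proof -
  have "has_bochner_integral lborel (\<lambda>x. gauss m p x * a + gauss m p x * x * b) (1 * a + m * b)"
    using assms
    by (intro has_bochner_integral_add has_bochner_integral_mult_left)
      (auto simp: gauss_def has_bochner_integral_iff integrable_normal_moment_nz_1
        integral_normal_moment_nz_1)
  then show ?thesis
    by (simp add: algebra_simps)
qed

lemma prob_space_gauss:
  assumes "p > 0"
  shows "prob_space (density lborel (\<lambda>x. ennreal (gauss m p x)))"
  using assms prob_space_normal_density[of "1 / sqrt p" m] by (simp add: gauss_def)

text \<open>Bayes' rule for a normal prior in \<open>t\<close> and a normal signal \<open>s\<close>,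
  by completing the square in \<open>t\<close>: prior times likelihood becomes posterior times
  marginal. The marginal precision \<open>p * q / (p + q)\<close> reflects that the variances
  \<open>1 / p\<close> and \<open>1 / q\<close> add.\<close>

lemma gauss_mult:
  assumes "p > 0" "q > 0"
  shows "gauss a p t * gauss t q s =
    gauss ((p * a + q * s) / (p + q)) (p + q) t * gauss a (p * q / (p + q)) s"
proof -
  define d where "d = p + q"
  have d: "d > 0"
    using assms by (simp add: d_def)
  define m where "m = (p * a + q * s) / d"
  have square: "p * (t - a)\<^sup>2 + q * (s - t)\<^sup>2 = d * (t - m)\<^sup>2 + p * q / d * (s - a)\<^sup>2"
  proof -
    \<comment> \<open>Multiplying by \<open>d\<close> turns the claim into a polynomial identity,
      since \<open>d * m\<close> is \<open>p * a + q * s\<close>.\<close>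
    have "d * (d * (t - m)\<^sup>2) = (d * t - d * m)\<^sup>2"
      by (simp add: power2_eq_square algebra_simps)
    also have "\<dots> = ((p + q) * t - (p * a + q * s))\<^sup>2"
      using d by (simp add: m_def d_def[symmetric])
    finally have "d * (d * (t - m)\<^sup>2) + p * q * (s - a)\<^sup>2
        = d * (p * (t - a)\<^sup>2 + q * (s - t)\<^sup>2)"
      by (simp add: d_def power2_eq_square algebra_simps)
    then show ?thesis
      using d by (simp add: field_simps)
  qed
  have coef: "sqrt (p / (2 * pi)) * sqrt (q / (2 * pi))
      = sqrt (d / (2 * pi)) * sqrt (p * q / d / (2 * pi))"
    using d by (simp add: real_sqrt_mult[symmetric])
  have "gauss a p t * gauss t q s = (sqrt (p / (2 * pi)) * sqrt (q / (2 * pi)))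
      * exp (- ((p * (t - a)\<^sup>2 + q * (s - t)\<^sup>2) / 2))"
    using assms by (simp add: gauss_eq_exp mult_exp_exp add_divide_distrib)
  also have "\<dots> = gauss m d t * gauss a (p * q / d) s"
    unfolding square coef using assms d
    by (simp add: gauss_eq_exp mult_exp_exp add_divide_distrib)
  finally show ?thesis
    by (simp add: m_def d_def)
qed

section \<open>Posterior laws of the state and the equilibrium threshold\<close>

lemma state_given_sender_eq_gauss:
  assumes "\<alpha> > 0" "\<beta> > 0" "\<gamma> > 0"
  shows "state_given_sender \<alpha> \<beta> \<gamma> \<mu> y =
    density lborel (\<lambda>\<theta>. ennreal (gauss ((\<gamma> * \<mu> + \<alpha> * y) / (\<gamma> + \<alpha>)) (\<gamma> + \<alpha>) \<theta>))"
proof -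
  \<comment> \<open>The marginal density of \<open>y\<close>. It is free of \<theta>, so it cancels
    against the normalising integral.\<close>
  define c where "c = gauss \<mu> (\<gamma> * \<alpha> / (\<gamma> + \<alpha>)) y"
  have "c > 0"
    using assms by (simp add: c_def gauss_pos)
  moreover have "state_sender_density \<alpha> \<beta> \<gamma> \<mu> \<theta> y
      = gauss ((\<gamma> * \<mu> + \<alpha> * y) / (\<gamma> + \<alpha>)) (\<gamma> + \<alpha>) \<theta> * c" for \<theta>
    using assms
    by (simp add: state_sender_density_def joint_density_def integral_gauss gauss_mult[of \<gamma> \<alpha>]
        mult.assoc mult.left_commute c_def)
  ultimately show ?thesis
    using assms by (simp add: state_given_sender_def integral_gauss)
qed

text \<open>Updating is sequential: the posterior after \<open>y\<close> serves as the prior for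
  \<open>x\<close>, so \<open>gauss_mult\<close> applies twice and the precisions add up.\<close>

lemma posterior_mean_eq:
  assumes "\<alpha> > 0" "\<beta> > 0" "\<gamma> > 0"
  shows "posterior_mean \<alpha> \<beta> \<gamma> \<mu> x y = (\<gamma> * \<mu> + \<alpha> * y + \<beta> * x) / (\<alpha> + \<beta> + \<gamma>)"
proof -
  define P m where "P = \<gamma> + \<alpha>" and "m = (\<gamma> * \<mu> + \<alpha> * y) / (\<gamma> + \<alpha>)"
  define M where "M = (P * m + \<beta> * x) / (P + \<beta>)"
  \<comment> \<open>The joint density of both signals: the marginal of \<open>y\<close> times the
    density of \<open>x\<close> given \<open>y\<close>.\<close>
  define c where "c = gauss \<mu> (\<gamma> * \<alpha> / P) y * gauss m (P * \<beta> / (P + \<beta>)) x"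
  have P: "P > 0"
    using assms by (simp add: P_def)
  have c: "c > 0"
    using assms P by (simp add: c_def gauss_pos)
  have "joint_density \<alpha> \<beta> \<gamma> \<mu> \<theta> x y = gauss M (P + \<beta>) \<theta> * c" for \<theta>
  proof -
    have "joint_density \<alpha> \<beta> \<gamma> \<mu> \<theta> x y = (gauss \<mu> \<gamma> \<theta> * gauss \<theta> \<alpha> y) * gauss \<theta> \<beta> x"
      by (simp add: joint_density_def)
    also have "\<dots> = (gauss m P \<theta> * gauss \<theta> \<beta> x) * gauss \<mu> (\<gamma> * \<alpha> / P) y"
      using assms by (simp add: gauss_mult m_def P_def)
    also have "gauss m P \<theta> * gauss \<theta> \<beta> x = gauss M (P + \<beta>) \<theta> * gauss m (P * \<beta> / (P + \<beta>)) x"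
      unfolding M_def using P assms(2) by (rule gauss_mult)
    finally show ?thesis
      by (simp add: c_def)
  qed
  then have "state_given_both \<alpha> \<beta> \<gamma> \<mu> x y
      = density lborel (\<lambda>\<theta>. ennreal (gauss M (P + \<beta>) \<theta>))"
    using P c assms by (simp add: state_given_both_def integral_gauss)
  then have "posterior_mean \<alpha> \<beta> \<gamma> \<mu> x y = (LINT \<theta>|lborel. gauss M (P + \<beta>) \<theta> * \<theta>)"
    by (simp add: posterior_mean_def integral_real_density gauss_nonneg)
  also have "\<dots> = M"
    using has_bochner_integral_integral_eq[OF has_bochner_integral_gauss_affine[of "P + \<beta>" M 0 1]]
      P assms by simp
  also have "M = (\<gamma> * \<mu> + \<alpha> * y + \<beta> * x) / (\<alpha> + \<beta> + \<gamma>)"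
    using P by (simp add: M_def m_def P_def add_ac)
  finally show ?thesis .
qed

lemma equilibrium_threshold_eq:
  assumes "\<alpha> > 0" "\<beta> > 0" "\<gamma> > 0"
  shows "equilibrium_threshold \<alpha> \<beta> \<gamma> \<mu> y = - (1 / \<beta>) * (\<alpha> * y + \<gamma> * \<mu>)"
  unfolding equilibrium_threshold_def
proof (rule the_equality)
  show "posterior_mean \<alpha> \<beta> \<gamma> \<mu> (- (1 / \<beta>) * (\<alpha> * y + \<gamma> * \<mu>)) y = 0"
    using assms by (simp add: posterior_mean_eq)
next
  fix x
  assume "posterior_mean \<alpha> \<beta> \<gamma> \<mu> x y = 0"
  then have "\<gamma> * \<mu> + \<alpha> * y + \<beta> * x = 0"
    using assms by (simp add: posterior_mean_eq)
  then show "x = - (1 / \<beta>) * (\<alpha> * y + \<gamma> * \<mu>)"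
    using assms by (simp add: field_simps)
qed

section \<open>The interim payoff as an integral over private signals\<close>

lemma one_minus_private_cdf:
  assumes "\<beta> > 0"
  shows "1 - private_cdf \<beta> x \<theta> = (LINT s|lborel. indicator {x<..} s * gauss \<theta> \<beta> s)"
proof -
  let ?N = "density lborel (\<lambda>s. ennreal (gauss \<theta> \<beta> s))"
  interpret prob_space ?N
    by (rule prob_space_gauss[OF assms])
  have "1 - private_cdf \<beta> x \<theta> = measure ?N {x<..}"
    using prob_compl[of "{..x}"]
    by (simp add: private_cdf_def cdf_def Compl_eq_Diff_UNIV[symmetric])
  also have "\<dots> = (LINT s|?N. indicator {x<..} s)"
    by simp
  also have "\<dots> = (LINT s|lborel. gauss \<theta> \<beta> s * indicator {x<..} s)"
    by (rule integral_real_density) (auto simp: gauss_nonneg)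
  finally show ?thesis
    by (simp add: mult.commute)
qed

text \<open>On the right, \<open>gauss m (P * \<beta> / (P + \<beta>))\<close> is the density of the
  private signal given \<open>y\<close>, and the fraction is the mean of the state given
  \<open>s\<close> and \<open>y\<close>. The threshold \<open>x\<close> survives only in the
  indicator.\<close>

lemma interim_payoff_eq:
  fixes \<alpha> \<beta> \<gamma> \<mu> r x y :: real
  assumes "\<alpha> > 0" "\<beta> > 0" "\<gamma> > 0"
  defines "P \<equiv> \<gamma> + \<alpha>" and "m \<equiv> (\<gamma> * \<mu> + \<alpha> * y) / (\<gamma> + \<alpha>)"
  shows "interim_payoff \<alpha> \<beta> \<gamma> \<mu> r x y = (LINT s|lborel. indicator {x<..} s *
    (gauss m (P * \<beta> / (P + \<beta>)) s * (r + (P * m + \<beta> * s) / (P + \<beta>))))"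
proof -
  have P: "P > 0"
    using assms by (simp add: P_def)
  let ?f = "\<lambda>\<theta> s. gauss m P \<theta> * (r + \<theta>) * (indicator {x<..} s * gauss \<theta> \<beta> s)"
  \<comment> \<open>Measurability in \<theta> comes from the representation as a parametrised
    integral, because \<open>private_cdf\<close> itself is the cdf of a measure that varies with
    \<theta>.\<close>
  have private_cdf_measurable: "private_cdf \<beta> x \<in> borel_measurable borel"
  proof -
    have "private_cdf \<beta> x = (\<lambda>\<theta>. 1 - (LINT s|lborel. indicator {x<..} s * gauss \<theta> \<beta> s))"
      using one_minus_private_cdf[OF assms(2)] by (auto simp: fun_eq_iff algebra_simps)
    also have "\<dots> \<in> borel_measurable borel"
      by measurable
    finally show ?thesis .
  qed
  have integrable_gauss_above: "integrable lborel (\<lambda>s. indicator {x<..} s * gauss \<theta> \<beta> s)" for \<theta>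
    using integrable_mult_indicator[OF _ integrable_gauss[OF assms(2), of \<theta>], of "{x<..}"]
    by simp
  have integrable_f: "integrable (lborel \<Otimes>\<^sub>M lborel) (case_prod ?f)"
  proof (rule lborel_pair.Fubini_integrable)
    \<comment> \<open>Domination: integrating the absolute value over \<open>s\<close> leaves the
      absolute value of this function times a tail probability, which is at most 1.\<close>
    have "integrable lborel (\<lambda>\<theta>. gauss m P \<theta> * (r + 1 * \<theta>))"
      using has_bochner_integral_gauss_affine[OF P] by (rule integrable.intros)
    then show "integrable lborel (\<lambda>\<theta>. LINT s|lborel. norm (case (\<theta>, s) of (\<theta>, s) \<Rightarrow> ?f \<theta> s))"
    proof (rule Bochner_Integration.integrable_bound)
      have "(LINT s|lborel. indicator {x<..} s * gauss \<theta> \<beta> s) \<le> 1" for \<theta>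
      proof -
        have "(LINT s|lborel. indicator {x<..} s * gauss \<theta> \<beta> s) \<le> (LINT s|lborel. gauss \<theta> \<beta> s)"
          by (intro integral_mono integrable_gauss_above integrable_gauss assms)
            (auto simp: indicator_def gauss_nonneg)
        then show ?thesis
          using assms by (simp add: integral_gauss)
      qed
      moreover have "0 \<le> (LINT s|lborel. indicator {x<..} s * gauss \<theta> \<beta> s)" for \<theta>
        by (simp add: gauss_nonneg)
      ultimately show "AE \<theta> in lborel. norm (LINT s|lborel. norm (case (\<theta>, s) of (\<theta>, s) \<Rightarrow> ?f \<theta> s))
          \<le> norm (gauss m P \<theta> * (r + 1 * \<theta>))"
        by (auto simp: abs_mult gauss_nonneg intro!: mult_right_le_one_le)
    qed measurable
    show "AE \<theta> in lborel. integrable lborel (\<lambda>s. case (\<theta>, s) of (\<theta>, s) \<Rightarrow> ?f \<theta> s)"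
      using integrable_gauss_above by auto
  qed measurable
  have "interim_payoff \<alpha> \<beta> \<gamma> \<mu> r x y
      = (LINT \<theta>|lborel. gauss m P \<theta> * ((r + \<theta>) * (1 - private_cdf \<beta> x \<theta>)))"
    unfolding interim_payoff_def state_given_sender_eq_gauss[OF assms(1-3)] P_def m_def
    using private_cdf_measurable by (intro integral_real_density) (auto simp: gauss_nonneg)
  also have "\<dots> = (LINT \<theta>|lborel. LINT s|lborel. ?f \<theta> s)"
    using assms by (simp add: one_minus_private_cdf mult.assoc)
  also have "\<dots> = (LINT s|lborel. LINT \<theta>|lborel. ?f \<theta> s)"
    using lborel_pair.Fubini_integral[OF integrable_f] by simp
  also have "(\<lambda>s. LINT \<theta>|lborel. ?f \<theta> s) = (\<lambda>s. indicator {x<..} s *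
      (gauss m (P * \<beta> / (P + \<beta>)) s * (r + (P * m + \<beta> * s) / (P + \<beta>))))"
  proof
    fix s
    let ?M = "(P * m + \<beta> * s) / (P + \<beta>)" and ?c = "gauss m (P * \<beta> / (P + \<beta>)) s"
    \<comment> \<open>The factor \<open>1 * \<theta>\<close> is kept to match the form
      \<open>a + b * x\<close> of the affine moment lemma.\<close>
    have integrand: "?f \<theta> s = (indicator {x<..} s * ?c) * (gauss ?M (P + \<beta>) \<theta> * (r + 1 * \<theta>))" for \<theta>
    proof -
      have "?f \<theta> s = indicator {x<..} s * (r + \<theta>) * (gauss m P \<theta> * gauss \<theta> \<beta> s)"
        by (simp only: mult_ac)
      then show ?thesis
        unfolding gauss_mult[OF P assms(2)] by (simp only: mult_ac mult_1)
    qed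
    have mean: "(LINT \<theta>|lborel. gauss ?M (P + \<beta>) \<theta> * (r + 1 * \<theta>)) = r + 1 * ?M"
      using P assms(2)
      by (intro has_bochner_integral_integral_eq has_bochner_integral_gauss_affine) simp
    show "(LINT \<theta>|lborel. ?f \<theta> s) = indicator {x<..} s * (?c * (r + ?M))"
      unfolding integrand integral_mult_right_zero mean by simp
  qed
  finally show ?thesis .
qed

section \<open>Single crossing and the unique maximiser\<close>

text \<open>Starting the integral below \<open>c\<close> includes negative values of
  \<open>f\<close>, and starting above \<open>c\<close> omits positive ones. Either way the loss is
  strict, because the interval between \<open>x\<close> and \<open>c\<close> has positive
  length.\<close>

lemma upper_integral_less_single_crossing:
  fixes f :: "real \<Rightarrow> real"
  assumes f: "integrable lborel f"
    and neg: "\<And>s. s < c \<Longrightarrow> f s < 0" and zero: "f c = 0" and pos: "\<And>s. c < s \<Longrightarrow> 0 < f s"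
    and "x \<noteq> c"
  shows "(LINT s|lborel. indicator {x<..} s * f s) < (LINT s|lborel. indicator {c<..} s * f s)"
proof -
  have int: "integrable lborel (\<lambda>s. indicator {a<..} s * f s)" for a
    using integrable_mult_indicator[OF _ f, of "{a<..}"] by simp
  \<comment> \<open>The pointwise loss: \<open>f\<close> on the half-open interval from
    \<open>c\<close> to \<open>x\<close> if \<open>c < x\<close>, minus \<open>f\<close> on the one
    from \<open>x\<close> to \<open>c\<close> if \<open>x < c\<close>, and 0 elsewhere. In the
    second case the endpoint \<open>c\<close> belongs to the interval, and there \<open>zero\<close>
    applies.\<close>
  define D where "D s = indicator {c<..} s * f s - indicator {x<..} s * f s" for s
  have D_int: "integrable lborel D"
    unfolding D_def using int by (intro Bochner_Integration.integrable_diff)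
  have D_nonneg: "D s \<ge> 0" for s
    using neg[of s] zero pos[of s]
    by (cases s c rule: linorder_cases) (auto simp: D_def indicator_def)
  have D_pos: "D s > 0" if "min x c < s" "s < max x c" for s
    using that neg[of s] pos[of s] by (auto simp: D_def indicator_def min_def max_def split: if_splits)
  \<comment> \<open>A nonnegative function with integral 0 vanishes almost everywhere, which would
    make the nonempty open interval between \<open>x\<close> and \<open>c\<close> a null
    set.\<close>
  have "integral\<^sup>L lborel D \<noteq> 0"
  proof
    assume "integral\<^sup>L lborel D = 0"
    then have "AE s in lborel. D s = 0"
      using integral_nonneg_eq_0_iff_AE[OF D_int] D_nonneg by simp
    then have "AE s in lborel. s \<notin> {min x c<..<max x c}"
      by eventually_elim (use D_pos in force)
    then have "{min x c<..<max x c} \<in> null_sets lborel"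
      by (subst (asm) AE_iff_null_sets[symmetric]) auto
    then show False
      using \<open>x \<noteq> c\<close> by (auto simp: null_sets_def min_def max_def split: if_splits)
  qed
  moreover have "integral\<^sup>L lborel D \<ge> 0"
    using D_nonneg by simp
  moreover have "integral\<^sup>L lborel D
      = (LINT s|lborel. indicator {c<..} s * f s) - (LINT s|lborel. indicator {x<..} s * f s)"
    unfolding D_def using int by (intro Bochner_Integration.integral_diff)
  ultimately show ?thesis
    by linarith
qed

lemma interim_payoff_less:
  fixes \<alpha> \<beta> \<gamma> \<mu> r x y :: real
  assumes "\<alpha> > 0" "\<beta> > 0" "\<gamma> > 0"
  defines "c \<equiv> - (1 / \<beta>) * (\<alpha> * y + \<gamma> * \<mu> + posterior_precision \<alpha> \<beta> \<gamma> * r)"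
  assumes "x \<noteq> c"
  shows "interim_payoff \<alpha> \<beta> \<gamma> \<mu> r x y < interim_payoff \<alpha> \<beta> \<gamma> \<mu> r c y"
proof -
  define P m where "P = \<gamma> + \<alpha>" and "m = (\<gamma> * \<mu> + \<alpha> * y) / (\<gamma> + \<alpha>)"
  define q where "q = P * \<beta> / (P + \<beta>)"
  have P: "P > 0" and q: "q > 0"
    using assms by (simp_all add: P_def q_def)
  let ?\<kappa> = "\<lambda>s. gauss m q s * (r + (P * m + \<beta> * s) / (P + \<beta>))"
  \<comment> \<open>In factored form the kernel shows its sign: positive slope
    \<open>\<beta> / (P + \<beta>)\<close> and root \<open>c\<close>, the signal at which the
    posterior mean equals \<open>- r\<close>.\<close>
  have crossing: "r + (P * m + \<beta> * s) / (P + \<beta>) = \<beta> / (P + \<beta>) * (s - c)" for s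
  proof -
    have "P * m = \<gamma> * \<mu> + \<alpha> * y"
      using P by (simp add: P_def m_def)
    moreover have "\<beta> * c = - (\<alpha> * y + \<gamma> * \<mu> + (P + \<beta>) * r)"
      using assms(2) by (simp add: c_def P_def posterior_precision_def add_ac)
    ultimately have "(P + \<beta>) * r + (P * m + \<beta> * s) = \<beta> * (s - c)"
      by (simp add: algebra_simps)
    then show ?thesis
      using P assms(2) by (simp add: field_simps)
  qed
  have "integrable lborel ?\<kappa>"
    using integrable.intros[OF has_bochner_integral_gauss_affine[OF q,
        of m "r + P * m / (P + \<beta>)" "\<beta> / (P + \<beta>)"]]
    by (simp add: add_divide_distrib add.assoc)
  moreover have "?\<kappa> s < 0" if "s < c" for s
    unfolding crossing using that P assms(2) gauss_pos[OF q]
    by (intro mult_pos_neg) auto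
  moreover have "?\<kappa> c = 0"
    unfolding crossing by simp
  moreover have "?\<kappa> s > 0" if "c < s" for s
    unfolding crossing using that P assms(2) gauss_pos[OF q]
    by (intro mult_pos_pos) auto
  ultimately have "(LINT s|lborel. indicator {x<..} s * ?\<kappa> s)
      < (LINT s|lborel. indicator {c<..} s * ?\<kappa> s)"
    using \<open>x \<noteq> c\<close> by (rule upper_integral_less_single_crossing)
  then show ?thesis
    unfolding interim_payoff_eq[OF assms(1-3)] P_def m_def q_def .
qed

theorem proposition3p2:
  fixes \<alpha> \<beta> \<gamma> \<mu> r y :: real
  assumes "\<alpha> > 0" and "\<beta> > 0" and "\<gamma> > 0"
  shows "(\<exists>!x. sender_optimal \<alpha> \<beta> \<gamma> \<mu> r y x) \<and>
    optimal_threshold \<alpha> \<beta> \<gamma> \<mu> r y =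
      - (1 / \<beta>) * (\<alpha> * y + \<gamma> * \<mu> + posterior_precision \<alpha> \<beta> \<gamma> * r) \<and>
    conflict \<alpha> \<beta> \<gamma> \<mu> r y = posterior_precision \<alpha> \<beta> \<gamma> / \<beta> * r"
proof -
  let ?c = "- (1 / \<beta>) * (\<alpha> * y + \<gamma> * \<mu> + posterior_precision \<alpha> \<beta> \<gamma> * r)"
  \<comment> \<open>Strict dominance by \<open>?c\<close> gives existence and uniqueness at once:
    nothing beats \<open>?c\<close>, and every other threshold is beaten by it.\<close>
  have optimal_iff: "sender_optimal \<alpha> \<beta> \<gamma> \<mu> r y x \<longleftrightarrow> x = ?c" for x
    unfolding sender_optimal_def is_arg_max_def
    using interim_payoff_less[OF assms] by (metis less_irrefl less_asym)
  then have threshold: "optimal_threshold \<alpha> \<beta> \<gamma> \<mu> r y = ?c"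
    by (simp add: optimal_threshold_def)
  moreover have "conflict \<alpha> \<beta> \<gamma> \<mu> r y = posterior_precision \<alpha> \<beta> \<gamma> / \<beta> * r"
    using assms unfolding conflict_def threshold
    by (simp add: equilibrium_threshold_eq field_simps)
  ultimately show ?thesis
    using optimal_iff by auto
qed

end
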